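(* Let $C\subseteq\mathbb{R}^m$ be nonempty, closed and convex, let $f:\mathbb{R}^m\to\mathbb{R}$ be differentiable on an open set containing $C$ with $\nabla f$ Lipschitz continuous on $C$, and assume that the problem $\min_{x\in C} f(x)$ has at least one solution. Let $x^0\in C$, $\lambda_0\in(0,+\infty)$, $\sigma,\kappa\in(0,1)$, and let $\{x^k\}$ be an infinite sequence generated by Algorithm GDA (defined in the context) for this problem from these data. Then the sequence $\{f(x^k)\}$ is convergent, and each limit point (if any) of the sequence $\{x^k\}$ is a stationary point of the problem. Moreover: (a) if $f$ is quasiconvex on $C$, then the sequence $\{x^k\}$ converges to a stationary point of the problem; (b) if $f$ is pseudoconvex on $C$, then the sequence $\{x^k\}$ converges to a solution of the problem.
   Context: $\langle\cdot,\cdot\rangle$ and $\|\cdot\|$ are the Euclidean inner product and norm on $\mathbb{R}^m$. For $x\in\mathbb{R}^m$, $P_C(x):=\operatorname{argmin}\{\|z-x\|: z\in C\}$ is the metric projection onto $C$. Problem: $\min_{x\in C} f(x)$. A solution is a point $x^*\in C$ with $f(x^* )\le f(x)$ for all $x\in C$. A stationary point of the problem is a point $\bar x\in C$ with $\langle\nabla f(\bar x), z-\bar x\rangle\ge 0$ for all $z\in C$. A limit point of a sequence is the limit of some subsequence. Algorithm GDA. Step 0: choose $x^0\in C$, $\lambda_0\in(0,+\infty)$, $\sigma,\kappa\in(0,1)$; set $k=0$. Step 1: given $x^k$ and $\lambda_k$, compute $x^{k+1}=P_C(x^k-\lambda_k\nabla f(x^k))$; if $f(x^{k+1})\le f(x^k)-\sigma\langle\nabla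 f(x^k),x^k-x^{k+1}\rangle$, set $\lambda_{k+1}:=\lambda_k$, otherwise set $\lambda_{k+1}:=\kappa\lambda_k$. Step 2: if $x^{k+1}=x^k$, stop; otherwise replace $k$ by $k+1$ and go to Step 1. The algorithm generates an infinite sequence if it never stops, i.e. $x^{k+1}\neq x^k$ for all $k\ge 0$. $f$ is quasiconvex on $C$ if $f(\lambda x+(1-\lambda)y)\le\max\{f(x),f(y)\}$ for all $x,y\in C$ and $\lambda\in[0,1]$. $f$ is pseudoconvex on $C$ if for all $x,y\in C$, $\langle\nabla f(x),y-x\rangle\ge 0$ implies $f(y)\ge f(x)$. *)

theory Defs
  imports "HOL-Analysis.Analysis"
begin

definition gradient :: "('a::euclidean_space \<Rightarrow> real) \<Rightarrow> 'a \<Rightarrow> 'a" where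
  "gradient f x = (THE D. GDERIV f x :> D)"

lemma gradient_eqI:
  fixes f :: "'a::euclidean_space \<Rightarrow> real"
  assumes "GDERIV f x :> D"
  shows "gradient f x = D"
  unfolding gradient_def
proof (rule the_equality)
  show "GDERIV f x :> D" by fact
next
  fix E assume "GDERIV f x :> E"
  then have "(\<lambda>h. h \<bullet> E) = (\<lambda>h. h \<bullet> D)"
    using assms unfolding gderiv_def by (rule has_derivative_unique)
  then show "E = D"
    by (metis vector_eq_ldot)
qed

lemma gderiv_gradient:
  fixes f :: "'a::euclidean_space \<Rightarrow> real"
  assumes "f differentiable (at x)"
  shows "GDERIV f x :> gradient f x"
proof -
  obtain f' where f': "(f has_derivative f') (at x)"
    using assms unfolding differentiable_def by blast
  then interpret bounded_linear f' by (rule has_derivative_bounded_linear)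
  have "f' h = h \<bullet> (adjoint f' 1)" for h
    using adjoint_works[OF linear, of h 1] by simp
  then have "GDERIV f x :> adjoint f' 1"
    using f' unfolding gderiv_def by (simp flip: \<open>\<And>h. f' h = h \<bullet> (adjoint f' 1)\<close>)
  then show ?thesis
    using gradient_eqI by metis
qed

definition is_solution :: "'a set \<Rightarrow> ('a \<Rightarrow> real) \<Rightarrow> 'a \<Rightarrow> bool" where
  "is_solution C f x \<longleftrightarrow> x \<in> C \<and> (\<forall>y\<in>C. f x \<le> f y)"

definition is_stationary :: "'a::euclidean_space set \<Rightarrow> ('a \<Rightarrow> real) \<Rightarrow> 'a \<Rightarrow> bool" where
  "is_stationary C f x \<longleftrightarrow> x \<in> C \<and> (\<forall>z\<in>C. gradient f x \<bullet> (z - x) \<ge> 0)"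

definition quasiconvex_on :: "'a::real_vector set \<Rightarrow> ('a \<Rightarrow> real) \<Rightarrow> bool" where
  "quasiconvex_on C f \<longleftrightarrow>
     (\<forall>x\<in>C. \<forall>y\<in>C. \<forall>t\<in>{0..1}. f (t *\<^sub>R x + (1 - t) *\<^sub>R y) \<le> max (f x) (f y))"

definition pseudoconvex_on :: "'a::euclidean_space set \<Rightarrow> ('a \<Rightarrow> real) \<Rightarrow> bool" where
  "pseudoconvex_on C f \<longleftrightarrow>
     (\<forall>x\<in>C. \<forall>y\<in>C. gradient f x \<bullet> (y - x) \<ge> 0 \<longrightarrow> f y \<ge> f x)"

(* A limit of some subsequence; unlike l islimpt range x, this also covers values
   that the sequence takes infinitely often. *)
definition seq_limit_point :: "(nat \<Rightarrow> 'a::topological_space) \<Rightarrow> 'a \<Rightarrow> bool" where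
  "seq_limit_point x l \<longleftrightarrow> (\<exists>r. strict_mono r \<and> (x \<circ> r) \<longlonglongrightarrow> l)"

(* The new point is accepted in either case; the sufficient-decrease test only decides the next
   step size. *)
definition gda_step ::
  "'a::euclidean_space set \<Rightarrow> ('a \<Rightarrow> real) \<Rightarrow> real \<Rightarrow> real \<Rightarrow> 'a \<Rightarrow> real \<Rightarrow> 'a \<Rightarrow> real \<Rightarrow> bool" where
  "gda_step C f \<sigma> \<kappa> x lam x' lam' \<longleftrightarrow>
     x' = closest_point C (x - lam *\<^sub>R gradient f x) \<and>
     lam' = (if f x' \<le> f x - \<sigma> * (gradient f x \<bullet> (x - x')) then lam else \<kappa> * lam)"

(* The last conjunct says that the stopping test never succeeds. *)
definition gda_infinite_sequence ::
  "'a::euclidean_space set \<Rightarrow> ('a \<Rightarrow> real) \<Rightarrow> 'a \<Rightarrow> real \<Rightarrow> real \<Rightarrow> real \<Rightarrow> (nat \<Rightarrow> 'a) \<Rightarrow> bool" where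
  "gda_infinite_sequence C f x0 lam0 \<sigma> \<kappa> x \<longleftrightarrow>
     (\<exists>lam. x 0 = x0 \<and> lam 0 = lam0 \<and>
        (\<forall>k. gda_step C f \<sigma> \<kappa> (x k) (lam k) (x (Suc k)) (lam (Suc k))) \<and>
        (\<forall>k. x (Suc k) \<noteq> x k))"

end

theory Submission
  imports Defs
begin

text \<open>
  The projection inequality at \<open>z = x\<^sub>k\<close> bounds the squared step length by
  \<open>\<lambda>\<^sub>k \<langle>\<nabla>f(x\<^sub>k), x\<^sub>k - x\<^sub>k\<^sub>+\<^sub>1\<rangle>\<close>, so the Lipschitz bound on the gradient makes the decrease test
  succeed once \<open>\<lambda>\<^sub>k\<close> is small; hence the step size is eventually a constant \<open>\<lambda>\<close>. From then on
  \<open>f(x\<^sub>k)\<close> decreases and the steps tend to \<open>0\<close>, so the projection inequality passes to the limit.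
  Quasiconvexity and pseudoconvexity both imply that \<open>\<langle>\<nabla>f(x\<^sub>k), z - x\<^sub>k\<rangle> \<le> 0\<close> whenever
  \<open>f z \<le> f(x\<^sub>k)\<close>, and then \<open>\<parallel>x\<^sub>k - z\<parallel>\<^sup>2 + (2\<lambda>/\<sigma>) f(x\<^sub>k)\<close> decreases. The iterates are therefore bounded,
  and, taking for \<open>z\<close> a limit point, they converge to it.
\<close>

section \<open>Derivatives along segments and an upper bound for the values\<close>

lemma has_real_derivative_along_segment:
  fixes f :: "'a::euclidean_space \<Rightarrow> real"
  assumes "f differentiable (at (x + t *\<^sub>R (y - x)))"
  shows "((\<lambda>t. f (x + t *\<^sub>R (y - x))) has_real_derivative
          gradient f (x + t *\<^sub>R (y - x)) \<bullet> (y - x)) (at t)"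
proof -
  let ?p = "x + t *\<^sub>R (y - x)"
  have f: "(f has_derivative (\<lambda>h. h \<bullet> gradient f ?p)) (at ?p)"
    using gderiv_gradient[OF assms] by (simp add: gderiv_def)
  have "((\<lambda>t. x + t *\<^sub>R (y - x)) has_derivative (\<lambda>h. h *\<^sub>R (y - x))) (at t)"
    by (auto intro!: derivative_eq_intros)
  from has_derivative_compose[OF this f] show ?thesis
    by (simp add: has_field_derivative_def inner_commute mult_commute_abs)
qed

lemma segment_mem_convex:
  assumes "convex C" "x \<in> C" "y \<in> C" "t \<in> {0..1::real}"
  shows "x + t *\<^sub>R (y - x) \<in> C"
  using convexD_alt[OF assms(1,2,3), of t] assms(4) by (simp add: algebra_simps)

text \<open>The mean value theorem supplies the gradient at an intermediate point, which differs
  from \<open>gradient f x\<close> by at most \<open>L * norm (y - x)\<close>. The constant is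
  \<open>L\<close> instead of the sharp \<open>L / 2\<close>, which only affects the threshold for
  the step size.\<close>

lemma lipschitz_gradient_upper_bound:
  fixes f :: "'a::euclidean_space \<Rightarrow> real"
  assumes C: "convex C" and diff: "\<And>p. p \<in> C \<Longrightarrow> f differentiable (at p)"
    and lip: "L-lipschitz_on C (gradient f)" and x: "x \<in> C" and y: "y \<in> C"
  shows "f y \<le> f x + gradient f x \<bullet> (y - x) + L * (norm (y - x))\<^sup>2"
proof -
  let ?p = "\<lambda>t. x + t *\<^sub>R (y - x)"
  have mem: "?p t \<in> C" if "0 \<le> t" "t \<le> 1" for t
    using segment_mem_convex[OF C x y] that by simp
  obtain t where t: "0 < t" "t < 1"
    and ft: "f (?p 1) - f (?p 0) = (1 - 0) * (gradient f (?p t) \<bullet> (y - x))"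
    using MVT2[of 0 1 "\<lambda>t. f (?p t)" "\<lambda>t. gradient f (?p t) \<bullet> (y - x)"]
      has_real_derivative_along_segment diff mem by (metis zero_less_one)
  have "norm (gradient f (?p t) - gradient f x) \<le> L * norm (?p t - x)"
    using lipschitz_onD[OF lip mem x, of t] t by (simp add: dist_norm)
  also have "\<dots> \<le> L * norm (y - x)"
    using t lipschitz_on_nonneg[OF lip]
    by (intro mult_left_mono) (auto simp: mult_left_le_one_le)
  finally have "norm (gradient f (?p t) - gradient f x) * norm (y - x) \<le> L * (norm (y - x))\<^sup>2"
    using mult_right_mono[OF _ norm_ge_zero[of "y - x"]]
    by (metis mult.assoc power2_eq_square)
  then have "(gradient f (?p t) - gradient f x) \<bullet> (y - x) \<le> L * (norm (y - x))\<^sup>2"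
    using norm_cauchy_schwarz order_trans by blast
  then show ?thesis
    using ft by (simp add: inner_diff_left)
qed

section \<open>First-order consequences of quasiconvexity and pseudoconvexity\<close>

lemma increases_along_segment:
  fixes f :: "'a::euclidean_space \<Rightarrow> real"
  assumes "f differentiable (at x)" and "gradient f x \<bullet> (y - x) > 0"
  obtains t where "0 < t" "t < 1" "f x < f (x + t *\<^sub>R (y - x))"
proof -
  have "((\<lambda>t. f (x + t *\<^sub>R (y - x))) has_real_derivative gradient f x \<bullet> (y - x)) (at 0)"
    using has_real_derivative_along_segment[of f x 0 y] assms(1) by simp
  from DERIV_pos_inc_right[OF this assms(2)]
  obtain d where d: "d > 0" "\<And>h. 0 < h \<Longrightarrow> h < d \<Longrightarrow> f x < f (x + h *\<^sub>R (y - x))"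
    by auto
  show thesis
    \<comment> \<open>Half of \<open>d\<close> stays where the value exceeds \<open>f x\<close>, and
      the cap \<open>1/2\<close> ensures \<open>t < 1\<close>.\<close>
    using that[of "min (d/2) (1/2)"] d by auto
qed

text \<open>A positive slope towards \<open>y\<close> would produce an intermediate point whose
  value exceeds \<open>f x\<close>, the larger of the two endpoint values.\<close>

lemma quasiconvex_on_gradient_le_0:
  assumes "quasiconvex_on C f" and "f differentiable (at x)"
    and "x \<in> C" "y \<in> C" and "f y \<le> f x"
  shows "gradient f x \<bullet> (y - x) \<le> 0"
proof (rule ccontr)
  assume "\<not> ?thesis"
  then obtain t where t: "0 < t" "t < 1" "f x < f (x + t *\<^sub>R (y - x))"
    using increases_along_segment[OF assms(2)] by (metis not_le)
  have "f (t *\<^sub>R y + (1 - t) *\<^sub>R x) \<le> max (f y) (f x)"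
    using assms(1,3,4) t unfolding quasiconvex_on_def by auto
  moreover have "t *\<^sub>R y + (1 - t) *\<^sub>R x = x + t *\<^sub>R (y - x)"
    by (simp add: algebra_simps)
  ultimately show False
    using t(3) assms(5) by simp
qed

text \<open>If \<open>f\<close> increased initially from \<open>x\<close> to \<open>y\<close>, it would attain its maximum over the segment at an
  interior critical point \<open>p\<close>, and pseudoconvexity would give \<open>f y \<ge> f p > f x\<close>.\<close>

lemma pseudoconvex_on_gradient_le_0:
  fixes f :: "'a::euclidean_space \<Rightarrow> real"
  assumes pc: "pseudoconvex_on C f" and C: "convex C"
    and diff: "\<And>p. p \<in> C \<Longrightarrow> f differentiable (at p)"
    and x: "x \<in> C" and y: "y \<in> C" and le: "f y \<le> f x"
  shows "gradient f x \<bullet> (y - x) \<le> 0"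
proof (rule ccontr)
  assume "\<not> ?thesis"
  then obtain s where s: "0 < s" "s < 1" "f x < f (x + s *\<^sub>R (y - x))"
    using increases_along_segment[OF diff[OF x]] by (metis not_le)
  let ?p = "\<lambda>t. x + t *\<^sub>R (y - x)"
  have mem: "?p t \<in> C" if "0 \<le> t" "t \<le> 1" for t
    using segment_mem_convex[OF C x y] that by simp
  have der: "((\<lambda>t. f (?p t)) has_real_derivative gradient f (?p t) \<bullet> (y - x)) (at t)"
    if "0 \<le> t" "t \<le> 1" for t
    using has_real_derivative_along_segment diff mem[OF that] by blast
  have "continuous_on {0..1} (\<lambda>t. f (?p t))"
    using der by (intro continuous_at_imp_continuous_on ballI) (auto intro: DERIV_isCont)
  then obtain t where t: "0 \<le> t" "t \<le> 1" and max: "\<And>u. 0 \<le> u \<Longrightarrow> u \<le> 1 \<Longrightarrow> f (?p u) \<le> f (?p t)"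
    using continuous_attains_sup[of "{0..1::real}" "\<lambda>t. f (?p t)"] by auto
  have gt: "f x < f (?p t)"
    using max[of s] s by simp
  have "t \<noteq> 0"
    using gt by auto
  moreover have "t \<noteq> 1"
    using gt le by auto
  ultimately have t': "0 < t" "t < 1"
    using t by auto
  \<comment> \<open>The radius \<open>min t (1 - t)\<close> keeps the neighbourhood of
    \<open>t\<close> inside the unit interval, so the maximum is local and the derivative
    vanishes.\<close>
  have "gradient f (?p t) \<bullet> (y - x) = 0"
    using DERIV_local_max[OF der[OF t], of "min t (1 - t)"] t' max by (auto simp: abs_if split: if_splits)
  moreover have "y - ?p t = (1 - t) *\<^sub>R (y - x)"
    by (simp add: algebra_simps)
  ultimately have "f (?p t) \<le> f y"
    using pc mem[OF t] y unfolding pseudoconvex_on_def by simp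
  then show False
    using gt le by simp
qed

lemma is_stationary_imp_is_solution:
  assumes "pseudoconvex_on C f" and "is_stationary C f l"
  shows "is_solution C f l"
  using assms unfolding pseudoconvex_on_def is_stationary_def is_solution_def by blast

section \<open>Stabilization of the step size\<close>

text \<open>Every failure of \<open>P\<close> costs a factor \<open>\<kappa>\<close>, so infinitely
  many failures would drive \<open>lam\<close> below \<open>\<delta>\<close>. From there on
  \<open>P\<close> holds, since \<open>lam\<close> never increases.\<close>

lemma backtracking_eventually_constant:
  fixes lam :: "nat \<Rightarrow> real"
  assumes pos: "lam 0 > 0" and \<kappa>: "0 < \<kappa>" "\<kappa> < 1" and \<delta>: "\<delta> > 0"
    and step: "\<And>k. lam (Suc k) = (if P k then lam k else \<kappa> * lam k)"
    and small: "\<And>k. lam k > 0 \<Longrightarrow> lam k \<le> \<delta> \<Longrightarrow> P k"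
  obtains N where "\<And>k. N \<le> k \<Longrightarrow> P k" "\<And>k. N \<le> k \<Longrightarrow> lam k = lam N" "lam N > 0"
proof -
  have lpos: "lam k > 0" for k
    by (induction k) (use pos \<kappa> step in auto)
  have "lam (Suc k) \<le> lam k" for k
    using step lpos[of k] \<kappa> by (simp add: mult_left_le_one_le)
  then have anti: "lam n \<le> lam m" if "m \<le> n" for m n
    using lift_Suc_antimono_le[of lam] that by blast
  have "\<exists>N. \<forall>k\<ge>N. P k"
  proof (rule ccontr)
    assume "\<not> ?thesis"
    then have fail: "\<And>N. \<exists>k\<ge>N. \<not> P k"
      by blast
    \<comment> \<open>Here \<open>n\<close> counts failures: the next failing index \<open>j\<close>
      after \<open>k\<close> gains one more factor at \<open>Suc j\<close>.\<close>
    have "\<exists>k. lam k \<le> \<kappa> ^ n * lam 0" for n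
    proof (induction n)
      case (Suc n)
      then obtain k where k: "lam k \<le> \<kappa> ^ n * lam 0" by blast
      obtain j where j: "j \<ge> k" "\<not> P j" using fail by blast
      have "lam (Suc j) \<le> \<kappa> * (\<kappa> ^ n * lam 0)"
        using step[of j] j anti[OF j(1)] k \<kappa> by simp
      then show ?case
        by (auto simp: mult.assoc)
    qed auto
    moreover have "(\<lambda>n. \<kappa> ^ n * lam 0) \<longlonglongrightarrow> 0"
      using \<kappa> by (intro tendsto_mult_left_zero LIMSEQ_power_zero) auto
    then have "\<forall>\<^sub>F n in sequentially. \<kappa> ^ n * lam 0 < \<delta>"
      using \<delta> by (rule order_tendstoD(2))
    then obtain n where "\<kappa> ^ n * lam 0 < \<delta>"
      by (auto simp: eventually_sequentially)
    ultimately obtain k where "lam k \<le> \<delta>"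
      by (meson less_imp_le order_trans)
    then have "P j" if "j \<ge> k" for j
      using small lpos anti[OF that] by (meson order_trans)
    then show False
      using fail by blast
  qed
  then obtain N where N: "\<And>k. N \<le> k \<Longrightarrow> P k" by blast
  have "lam k = lam N" if "N \<le> k" for k
    using that by (induction k rule: dec_induct) (auto simp: step N)
  then show thesis
    using that N lpos by blast
qed

text \<open>Dropping the first \<open>N\<close> entries of \<open>r\<close> leaves indices that are
  at least \<open>N\<close>, so the subtraction of natural numbers is exact.\<close>

lemma seq_limit_point_shift:
  assumes "seq_limit_point x l"
  shows "seq_limit_point (\<lambda>k. x (k + N)) l"
proof -
  obtain r where r: "strict_mono r" "(x \<circ> r) \<longlonglongrightarrow> l"
    using assms unfolding seq_limit_point_def by blast
  have ge: "N \<le> r (k + N)" for k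
    using seq_suble[OF r(1), of "k + N"] by simp
  have "strict_mono (\<lambda>k. r (k + N) - N)"
    using r(1) ge by (auto simp: strict_mono_def intro!: diff_less_mono)
  moreover have "((\<lambda>k. x (k + N)) \<circ> (\<lambda>k. r (k + N) - N)) \<longlonglongrightarrow> l"
    using LIMSEQ_ignore_initial_segment[OF r(2), of N] ge by (simp add: o_def)
  ultimately show ?thesis
    unfolding seq_limit_point_def by blast
qed

lemma decseq_lower_bound_convergent:
  fixes a :: "nat \<Rightarrow> real"
  assumes "decseq a" and "\<And>k. c \<le> a k"
  shows "convergent a"
proof -
  obtain l where "a \<longlonglongrightarrow> l"
    using decseq_convergent[OF assms(1), of c] assms(2) by blast
  then show ?thesis
    by (rule convergentI)
qed

text \<open>The tail of a GDA run, after the step size has become constant; \<open>projection\<close> is the variational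
  characterization of the projection step.\<close>

locale gda_tail =
  fixes C :: "'a::euclidean_space set" and f :: "'a \<Rightarrow> real" and L lam \<sigma> c :: real
    and x :: "nat \<Rightarrow> 'a"
  assumes closed: "closed C"
    and diff: "\<And>p. p \<in> C \<Longrightarrow> f differentiable (at p)"
    and lip: "L-lipschitz_on C (gradient f)"
    and lam: "lam > 0" and \<sigma>: "\<sigma> > 0"
    and x_in: "\<And>k. x k \<in> C"
    and lower: "\<And>k. c \<le> f (x k)"
    and projection: "\<And>k z. z \<in> C \<Longrightarrow>
      (x k - x (Suc k)) \<bullet> (z - x (Suc k)) \<le> lam * (gradient f (x k) \<bullet> (z - x (Suc k)))"
    and decrease: "\<And>k. f (x (Suc k)) \<le> f (x k) - \<sigma> * (gradient f (x k) \<bullet> (x k - x (Suc k)))"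
begin

section \<open>Decrease of the values and vanishing steps\<close>

text \<open>With \<open>z = x k\<close> the left side of \<open>projection\<close> is the squared
  step length, and \<open>decrease\<close> bounds the right side by the drop in value.\<close>

lemma step_le: "(norm (x k - x (Suc k)))\<^sup>2 \<le> lam / \<sigma> * (f (x k) - f (x (Suc k)))"
proof -
  have "(norm (x k - x (Suc k)))\<^sup>2 \<le> lam * (gradient f (x k) \<bullet> (x k - x (Suc k)))"
    using projection[OF x_in, of k k] by (simp add: power2_norm_eq_inner)
  also have "\<dots> \<le> lam * ((f (x k) - f (x (Suc k))) / \<sigma>)"
    using decrease[of k] lam \<sigma> by (intro mult_left_mono) (auto simp: field_simps)
  finally show ?thesis by simp
qed

lemma decseq_values: "decseq (\<lambda>k. f (x k))"
proof (rule decseq_SucI)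
  fix k
  have "0 \<le> lam / \<sigma> * (f (x k) - f (x (Suc k)))"
    using step_le[of k] by (meson order_trans zero_le_power2)
  then show "f (x (Suc k)) \<le> f (x k)"
    using lam \<sigma> by (simp add: zero_le_mult_iff zero_le_divide_iff)
qed

lemma convergent_values: "convergent (\<lambda>k. f (x k))"
  using decseq_values lower by (rule decseq_lower_bound_convergent)

lemma steps_tendsto_0: "(\<lambda>k. x k - x (Suc k)) \<longlonglongrightarrow> 0"
proof -
  obtain a where a: "(\<lambda>k. f (x k)) \<longlonglongrightarrow> a"
    using convergent_values by (auto simp: convergent_def)
  have "(\<lambda>k. lam / \<sigma> * (f (x k) - f (x (Suc k)))) \<longlonglongrightarrow> lam / \<sigma> * (a - a)"
    by (intro tendsto_intros a LIMSEQ_Suc)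
  then have lim: "(\<lambda>k. lam / \<sigma> * (f (x k) - f (x (Suc k)))) \<longlonglongrightarrow> 0"
    by simp
  have "(\<lambda>k. (norm (x k - x (Suc k)))\<^sup>2) \<longlonglongrightarrow> 0"
    by (rule tendsto_sandwich[OF _ _ tendsto_const lim]) (use step_le in auto)
  then have "(\<lambda>k. norm (x k - x (Suc k))) \<longlonglongrightarrow> 0"
    by simp
  then show ?thesis
    by (rule tendsto_norm_zero_cancel)
qed

section \<open>Limit points and convergence of the iterates\<close>

text \<open>Since the steps vanish, \<open>x (r k)\<close> and its successor share the limit
  \<open>l\<close>. The gradient is continuous on \<open>C\<close>, so \<open>projection\<close>
  passes to the limit with left side tending to 0.\<close>

lemma limit_point_stationary:
  assumes "seq_limit_point x l"
  shows "is_stationary C f l"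
proof -
  obtain r where r: "strict_mono r" "(x \<circ> r) \<longlonglongrightarrow> l"
    using assms unfolding seq_limit_point_def by blast
  have xr: "(\<lambda>k. x (r k)) \<longlonglongrightarrow> l"
    using r by (simp add: o_def)
  have l: "l \<in> C"
    using closed_sequentially[OF closed _ xr] x_in by blast
  have dr: "(\<lambda>k. x (r k) - x (Suc (r k))) \<longlonglongrightarrow> 0"
    using LIMSEQ_subseq_LIMSEQ[OF steps_tendsto_0 r(1)] by (simp add: o_def)
  have xs: "(\<lambda>k. x (Suc (r k))) \<longlonglongrightarrow> l"
    using tendsto_diff[OF xr dr] by simp
  have gr: "(\<lambda>k. gradient f (x (r k))) \<longlonglongrightarrow> gradient f l"
    using lipschitz_on_continuous_on[OF lip] xr l x_in
    by (auto intro: continuous_on_tendsto_compose)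
  have "0 \<le> gradient f l \<bullet> (z - l)" if "z \<in> C" for z
  proof -
    have "0 \<bullet> (z - l) \<le> lam * (gradient f l \<bullet> (z - l))"
    proof (rule LIMSEQ_le)
      show "(\<lambda>k. (x (r k) - x (Suc (r k))) \<bullet> (z - x (Suc (r k)))) \<longlonglongrightarrow> 0 \<bullet> (z - l)"
        by (intro tendsto_intros dr xs)
      show "(\<lambda>k. lam * (gradient f (x (r k)) \<bullet> (z - x (Suc (r k)))))
              \<longlonglongrightarrow> lam * (gradient f l \<bullet> (z - l))"
        by (intro tendsto_intros gr xs)
    qed (use projection[OF that] in blast)
    then show ?thesis
      using lam by (simp add: zero_le_mult_iff)
  qed
  then show ?thesis
    using l by (simp add: is_stationary_def)
qed

text \<open>The sum \<open>?b\<close> decreases and is bounded below. Its second term converges with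
  the values, hence so does the first.\<close>

lemma dist_convergent:
  assumes z: "z \<in> C" and acute: "\<And>k. gradient f (x k) \<bullet> (z - x k) \<le> 0"
  shows "convergent (\<lambda>k. (norm (x k - z))\<^sup>2)"
proof -
  let ?b = "\<lambda>k. (norm (x k - z))\<^sup>2 + 2 * lam / \<sigma> * f (x k)"
  have "?b (Suc k) \<le> ?b k" for k
  proof -
    let ?g = "gradient f (x k)"
    \<comment> \<open>Law of cosines for the triangle with vertices \<open>x k\<close>,
      \<open>x (Suc k)\<close> and \<open>z\<close>.\<close>
    have "(norm (x (Suc k) - z))\<^sup>2 + (norm (x k - x (Suc k)))\<^sup>2 =
        (norm (x k - z))\<^sup>2 + 2 * ((x k - x (Suc k)) \<bullet> (z - x (Suc k)))"
      by (simp add: power2_norm_eq_inner inner_commute algebra_simps)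
    moreover have "(x k - x (Suc k)) \<bullet> (z - x (Suc k)) \<le> lam / \<sigma> * (f (x k) - f (x (Suc k)))"
    proof -
      have "(x k - x (Suc k)) \<bullet> (z - x (Suc k)) \<le> lam * (?g \<bullet> (z - x (Suc k)))"
        by (rule projection[OF z])
      \<comment> \<open>Splitting at \<open>x k\<close> isolates a term that \<open>acute\<close>
        makes nonpositive and one that \<open>decrease\<close> controls.\<close>
      also have "?g \<bullet> (z - x (Suc k)) = ?g \<bullet> (z - x k) + ?g \<bullet> (x k - x (Suc k))"
        by (simp add: inner_diff_right)
      also have "lam * \<dots> \<le> lam * ((f (x k) - f (x (Suc k))) / \<sigma>)"
      proof (intro mult_left_mono)
        have "?g \<bullet> (x k - x (Suc k)) \<le> (f (x k) - f (x (Suc k))) / \<sigma>"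
          using decrease[of k] \<sigma> by (simp add: field_simps)
        then show "?g \<bullet> (z - x k) + ?g \<bullet> (x k - x (Suc k)) \<le> (f (x k) - f (x (Suc k))) / \<sigma>"
          using acute[of k] by linarith
      qed (use lam in simp)
      finally show ?thesis by simp
    qed
    ultimately have "(norm (x (Suc k) - z))\<^sup>2
        \<le> (norm (x k - z))\<^sup>2 + 2 * (lam / \<sigma> * (f (x k) - f (x (Suc k))))"
      using zero_le_power2[of "norm (x k - x (Suc k))"] by linarith
    then show ?thesis
      by (simp add: right_diff_distrib diff_divide_distrib)
  qed
  then have "decseq ?b"
    by (rule decseq_SucI)
  moreover have "2 * lam / \<sigma> * c \<le> ?b k" for k
  proof -
    have "2 * lam / \<sigma> * c \<le> 2 * lam / \<sigma> * f (x k)"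
      using lam \<sigma> lower by (intro mult_left_mono) auto
    then show ?thesis
      using zero_le_power2[of "norm (x k - z)"] by linarith
  qed
  ultimately have "convergent ?b"
    by (rule decseq_lower_bound_convergent)
  moreover have "convergent (\<lambda>k. 2 * lam / \<sigma> * f (x k))"
    using convergent_values by (intro convergent_mult convergent_const)
  ultimately have "convergent (\<lambda>k. ?b k - 2 * lam / \<sigma> * f (x k))"
    by (rule convergent_diff)
  then show ?thesis by simp
qed

text \<open>The premise \<open>acute\<close> is the common consequence of both generalized convexity
  assumptions. It is applied at \<open>s\<close> to get boundedness, then at a limit point
  \<open>l\<close> to get convergence of the whole sequence.\<close>

lemma converges_to_stationary:
  assumes acute: "\<And>p z. p \<in> C \<Longrightarrow> z \<in> C \<Longrightarrow> f z \<le> f p \<Longrightarrow> gradient f p \<bullet> (z - p) \<le> 0"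
    and s: "is_solution C f s"
  shows "\<exists>l. is_stationary C f l \<and> x \<longlonglongrightarrow> l"
proof -
  have "convergent (\<lambda>k. (norm (x k - s))\<^sup>2)"
    using s x_in acute by (intro dist_convergent) (auto simp: is_solution_def)
  then have "convergent (\<lambda>k. sqrt ((norm (x k - s))\<^sup>2))"
    by (auto simp: convergent_def simp del: real_sqrt_abs intro: tendsto_real_sqrt)
  then have "Bseq (\<lambda>k. norm (x k - s))"
    using convergent_imp_Bseq by simp
  then obtain K where "\<And>k. norm (x k - s) \<le> K"
    by (auto simp: Bseq_def)
  then have "bounded (range x)"
    unfolding bounded_def by (intro exI[of _ s] exI[of _ K]) (auto simp: dist_norm norm_minus_commute)
  then obtain l r where r: "strict_mono r" and lim: "(x \<circ> r) \<longlonglongrightarrow> l"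
    using bounded_imp_convergent_subsequence by blast
  then have stat: "is_stationary C f l"
    by (intro limit_point_stationary) (auto simp: seq_limit_point_def)
  then have l: "l \<in> C"
    by (simp add: is_stationary_def)
  \<comment> \<open>Continuity at \<open>l\<close> identifies the limit of the decreasing values as
    \<open>f l\<close>, so no iterate has a smaller value and \<open>acute\<close> applies with
    \<open>z = l\<close>.\<close>
  have "(\<lambda>k. f (x (r k))) \<longlonglongrightarrow> f l"
    using isCont_tendsto_compose[OF differentiable_imp_continuous_within[OF diff[OF l]] lim]
    by (simp add: o_def)
  moreover obtain a where a: "(\<lambda>k. f (x k)) \<longlonglongrightarrow> a"
    using convergent_values by (auto simp: convergent_def)
  ultimately have "a = f l"
    using LIMSEQ_subseq_LIMSEQ[OF a r] LIMSEQ_unique by (auto simp: o_def)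
  then have "f l \<le> f (x k)" for k
    using decseq_ge[OF decseq_values a] by simp
  then have "convergent (\<lambda>k. (norm (x k - l))\<^sup>2)"
    using acute x_in l by (intro dist_convergent) auto
  then obtain d where d: "(\<lambda>k. (norm (x k - l))\<^sup>2) \<longlonglongrightarrow> d"
    by (auto simp: convergent_def)
  \<comment> \<open>The squared distances converge along the whole sequence, so their limit can be
    read off along \<open>r\<close>, where it is 0.\<close>
  have "(\<lambda>k. (norm (x (r k) - l))\<^sup>2) \<longlonglongrightarrow> (norm (l - l))\<^sup>2"
    using lim by (intro tendsto_intros) (simp add: o_def)
  moreover have "(\<lambda>k. (norm (x (r k) - l))\<^sup>2) \<longlonglongrightarrow> d"
    using LIMSEQ_subseq_LIMSEQ[OF d r] by (simp add: o_def)
  ultimately have "d = (norm (l - l))\<^sup>2"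
    by (rule LIMSEQ_unique[rotated])
  then have "(\<lambda>k. norm (x k - l)) \<longlonglongrightarrow> 0"
    using d by simp
  then have "x \<longlonglongrightarrow> l"
    by (simp add: LIM_zero_iff tendsto_norm_zero_iff)
  then show ?thesis
    using stat by blast
qed

end

section \<open>From a run of the algorithm to its tail, and the theorem\<close>

lemma gda_tail_exists:
  fixes f :: "'a::euclidean_space \<Rightarrow> real"
  assumes C: "closed C" "convex C" and diff: "\<And>p. p \<in> C \<Longrightarrow> f differentiable (at p)"
    and lip: "L-lipschitz_on C (gradient f)" and s: "is_solution C f s"
    and x0: "x0 \<in> C" "lam0 > 0" and \<sigma>: "0 < \<sigma>" "\<sigma> < 1" and \<kappa>: "0 < \<kappa>" "\<kappa> < 1"
    and run: "gda_infinite_sequence C f x0 lam0 \<sigma> \<kappa> x"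
  obtains N lam where "gda_tail C f L lam \<sigma> (f s) (\<lambda>k. x (k + N))"
proof -
  obtain lam where init: "x 0 = x0" "lam 0 = lam0"
    and step: "\<And>k. gda_step C f \<sigma> \<kappa> (x k) (lam k) (x (Suc k)) (lam (Suc k))"
    using run unfolding gda_infinite_sequence_def by blast
  have xS: "x (Suc k) = closest_point C (x k - lam k *\<^sub>R gradient f (x k))" for k
    using step unfolding gda_step_def by blast
  have x_in: "x k \<in> C" for k
    using x0 closest_point_in_set[OF C(1)] by (cases k) (auto simp: init xS)
  \<comment> \<open>The obtuse-angle property of the projection, with the gradient term moved to the
    right.\<close>
  have projection: "(x k - x (Suc k)) \<bullet> (z - x (Suc k))
      \<le> lam k * (gradient f (x k) \<bullet> (z - x (Suc k)))" if "z \<in> C" for k z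
    using closest_point_dot[OF C(2,1) that, of "x k - lam k *\<^sub>R gradient f (x k)"]
    by (simp add: xS[symmetric] inner_diff_left)
  let ?P = "\<lambda>k. f (x (Suc k)) \<le> f (x k) - \<sigma> * (gradient f (x k) \<bullet> (x k - x (Suc k)))"
  \<comment> \<open>Chosen so that \<open>L * \<delta> \<le> 1 - \<sigma>\<close>; the denominator
    \<open>L + 1\<close> is positive even when \<open>L = 0\<close>.\<close>
  define \<delta> where "\<delta> = (1 - \<sigma>) / (L + 1)"
  have L: "L \<ge> 0"
    using lip by (rule lipschitz_on_nonneg)
  have \<delta>: "\<delta> > 0"
    using \<sigma> L by (simp add: \<delta>_def)
  have small: "?P k" if pos: "lam k > 0" and le: "lam k \<le> \<delta>" for k
  proof -
    let ?w = "gradient f (x k) \<bullet> (x k - x (Suc k))"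
    have sq: "(norm (x (Suc k) - x k))\<^sup>2 \<le> lam k * ?w"
      using projection[OF x_in, of k k]
      by (simp add: norm_minus_commute flip: power2_norm_eq_inner)
    then have "0 \<le> lam k * ?w"
      by (meson order_trans zero_le_power2)
    then have w: "0 \<le> ?w"
      using pos by (simp add: zero_le_mult_iff)
    \<comment> \<open>The quadratic error is at most \<open>(1 - \<sigma>) * ?w\<close>, so at least
      the fraction \<open>\<sigma>\<close> of the first-order decrease \<open>?w\<close>
      survives.\<close>
    have "L * lam k \<le> (L + 1) * \<delta>"
      using L le pos by (intro mult_mono) auto
    also have "\<dots> = 1 - \<sigma>"
      using L by (simp add: \<delta>_def)
    finally have "L * lam k * ?w \<le> (1 - \<sigma>) * ?w"
      using w by (rule mult_right_mono)
    moreover have "L * (norm (x (Suc k) - x k))\<^sup>2 \<le> L * lam k * ?w"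
      using mult_left_mono[OF sq L] by (simp add: mult.assoc)
    moreover have "f (x (Suc k)) \<le> f (x k) - ?w + L * (norm (x (Suc k) - x k))\<^sup>2"
      using lipschitz_gradient_upper_bound[OF C(2) diff lip x_in x_in, of "Suc k" k]
      by (simp add: inner_diff_right)
    ultimately show ?thesis
      by (simp add: left_diff_distrib)
  qed
  have lamS: "lam (Suc k) = (if ?P k then lam k else \<kappa> * lam k)" for k
    using step unfolding gda_step_def by blast
  have "lam 0 > 0"
    using init x0 by simp
  from backtracking_eventually_constant[OF this \<kappa> \<delta> lamS small]
  obtain N where N: "\<And>k. N \<le> k \<Longrightarrow> ?P k" "\<And>k. N \<le> k \<Longrightarrow> lam k = lam N" "lam N > 0"
    by blast
  have "gda_tail C f L (lam N) \<sigma> (f s) (\<lambda>k. x (k + N))"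
  proof
    show "f s \<le> f (x (k + N))" for k
      using s x_in by (simp add: is_solution_def)
    show "(x (k + N) - x (Suc k + N)) \<bullet> (z - x (Suc k + N))
        \<le> lam N * (gradient f (x (k + N)) \<bullet> (z - x (Suc k + N)))" if "z \<in> C" for k z
      using projection[OF that, of "k + N"] N(2)[of "k + N"] by simp
    show "f (x (Suc k + N)) \<le> f (x (k + N))
        - \<sigma> * (gradient f (x (k + N)) \<bullet> (x (k + N) - x (Suc k + N)))" for k
      using N(1)[of "k + N"] by simp
  qed (use C diff lip N(3) \<sigma> x_in in auto)
  then show thesis
    by (rule that)
qed

theorem theorem1:
  fixes C S :: "(real ^ 'm) set" and f :: "real ^ 'm \<Rightarrow> real"
    and x0 :: "real ^ 'm" and lam0 \<sigma> \<kappa> :: real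
    and x :: "nat \<Rightarrow> real ^ 'm"
  assumes "C \<noteq> {}" and "closed C" and "convex C"
    and "open S" and "C \<subseteq> S" and "f differentiable_on S"
    and "\<exists>L. L-lipschitz_on C (gradient f)"
    and "\<exists>xs. is_solution C f xs"
    and "x0 \<in> C" and "lam0 > 0"
    and "0 < \<sigma>" and "\<sigma> < 1" and "0 < \<kappa>" and "\<kappa> < 1"
    and "gda_infinite_sequence C f x0 lam0 \<sigma> \<kappa> x"
  shows "convergent (\<lambda>k. f (x k)) \<and>
         (\<forall>l. seq_limit_point x l \<longrightarrow> is_stationary C f l) \<and>
         (quasiconvex_on C f \<longrightarrow> (\<exists>l. is_stationary C f l \<and> x \<longlonglongrightarrow> l)) \<and>
         (pseudoconvex_on C f \<longrightarrow> (\<exists>l. is_solution C f l \<and> x \<longlonglongrightarrow> l))"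
proof -
  have diff: "f differentiable (at p)" if "p \<in> C" for p
    using assms(4,5,6) that by (auto simp: differentiable_on_eq_differentiable_at)
  obtain L s where lip: "L-lipschitz_on C (gradient f)" and s: "is_solution C f s"
    using assms(7,8) by blast
  obtain N lam where "gda_tail C f L lam \<sigma> (f s) (\<lambda>k. x (k + N))"
    by (rule gda_tail_exists[OF assms(2,3) diff lip s assms(9-15)])
  then interpret gda_tail C f L lam \<sigma> "f s" "\<lambda>k. x (k + N)" .
  \<comment> \<open>The interpretation speaks of the shifted sequence; its limit is also the limit
    of \<open>x\<close>.\<close>
  have conv: "\<exists>l. is_stationary C f l \<and> x \<longlonglongrightarrow> l"
    if "\<And>p z. p \<in> C \<Longrightarrow> z \<in> C \<Longrightarrow> f z \<le> f p \<Longrightarrow> gradient f p \<bullet> (z - p) \<le> 0"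
    using converges_to_stationary[OF that s] LIMSEQ_offset by blast
  have "convergent (\<lambda>k. f (x k))"
    using convergent_values convergent_ignore_initial_segment by blast
  moreover have "is_stationary C f l" if "seq_limit_point x l" for l
    using limit_point_stationary seq_limit_point_shift[OF that] by blast
  moreover have "\<exists>l. is_stationary C f l \<and> x \<longlonglongrightarrow> l" if "quasiconvex_on C f"
    using conv quasiconvex_on_gradient_le_0[OF that diff] by blast
  moreover have "\<exists>l. is_solution C f l \<and> x \<longlonglongrightarrow> l" if "pseudoconvex_on C f"
    using conv pseudoconvex_on_gradient_le_0[OF that assms(3) diff]
      is_stationary_imp_is_solution[OF that] by blast
  ultimately show ?thesis
    by blast
qed

end
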